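(* Let $\mathcal{X}$ be a finite set with $|\mathcal{X}|\ge2$, $(\mathcal{X},\mathcal{E})$ a strongly connected directed graph, and $\mathcal{V}(\mathcal{X},\mathcal{E})=\{P_\theta:\theta\in\Theta\}$ an e-family of irreducible transition kernels over $(\mathcal{X},\mathcal{E})$ with natural parameter $\theta$, generated by the carrier kernel $K$ and the generator functions $g_1,\dots,g_d$. The following are equivalent: (i) $\mathcal{V}(\mathcal{X},\mathcal{E})$ is reversible, i.e. every $P\in\mathcal{V}(\mathcal{X},\mathcal{E})$ is reversible. (ii) $\mathcal{E}=\mathcal{E}^\star$, and $K$ and $g_1,\dots,g_d$ are all log-reversible functions over $(\mathcal{X},\mathcal{E})$.
   Context: $\mathcal{E}^\star=\{(x,x'):(x',x)\in\mathcal{E}\}$. $\mathcal{W}(\mathcal{X},\mathcal{E})$: row-stochastic matrices $P$ on $\mathcal{X}$ with $P(x,x')>0$ exactly for $(x,x')\in\mathcal{E}$; such $P$ has a unique stationary distribution $\pi>0$. $P$ is reversible if $\pi(x)P(x,x')=\pi(x')P(x',x)$ for all $x,x'$. e-family over $(\mathcal{X},\mathcal{E})$ generated by $K:\mathcal{X}^2\to\mathbb{R}$ and $g_1,\dots,g_d:\mathcal{X}^2\to\mathbb{R}$: a family $\{P_\theta:\theta\in\Theta\}\subset\mathcal{W}(\mathcal{X},\mathcal{E})$, with $\Theta\subset\mathbb{R}^d$ connected and containing an open ball centered at $0$, for which there are $R:\Theta\times\mathcal{X}\to\mathbb{R}$, $\psi:\Theta\to\mathbb{R}$ with $\log P_\theta(x,x')=K(x,x')+\sum_{i=1}^d\theta^ig_i(x,x')+R(\theta,x')-R(\theta,x)-\psi(\theta)$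 for $(x,x')\in\mathcal{E}$ and $P_\theta(x,x')=0$ otherwise. Only the values of $K,g_i$ on $\mathcal{E}$ matter. It is assumed that $g_1,\dots,g_d$ are linearly independent modulo functions on $\mathcal{E}$ of the form $(x,x')\mapsto f(x')-f(x)+c$. For $\mathcal{E}=\mathcal{E}^\star$, a function $h$ on $\mathcal{E}$ is log-reversible if for every finite directed closed path $(x_1,x_2),(x_2,x_3),\dots,(x_{n-1},x_n),(x_n,x_{n+1})$ of edges in $\mathcal{E}$ with $x_{n+1}=x_1$ (vertices may repeat), $\sum_{t=1}^nh(x_t,x_{t+1})=\sum_{t=1}^nh(x_{t+1},x_t)$. *)

theory Defs
  imports "HOL-Analysis.Analysis"
begin

text \<open>
  The state space is a finite carrier set \<open>X\<close> and the edge set is a relation \<open>E \<subseteq> X \<times> X\<close>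
  (self-loops allowed); \<open>\<E>\<^sup>\<star>\<close> is the converse relation.  Functions on \<open>X\<^sup>2\<close> are curried HOL
  functions, of which only the values on \<open>X\<close> are ever constrained or used.
\<close>

definition strongly_connected_on :: "'a set \<Rightarrow> ('a \<times> 'a) set \<Rightarrow> bool" where
  "strongly_connected_on X E \<longleftrightarrow> E \<subseteq> X \<times> X \<and> (\<forall>x\<in>X. \<forall>y\<in>X. (x, y) \<in> E\<^sup>*)"

definition row_stochastic :: "'a set \<Rightarrow> ('a \<Rightarrow> 'a \<Rightarrow> real) \<Rightarrow> bool" where
  "row_stochastic X P \<longleftrightarrow>
     (\<forall>x\<in>X. \<forall>y\<in>X. 0 \<le> P x y) \<and> (\<forall>x\<in>X. (\<Sum>y\<in>X. P x y) = 1)"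

definition transition_kernels :: "'a set \<Rightarrow> ('a \<times> 'a) set \<Rightarrow> ('a \<Rightarrow> 'a \<Rightarrow> real) set" where
  "transition_kernels X E =
     {P. row_stochastic X P \<and> (\<forall>x\<in>X. \<forall>y\<in>X. 0 < P x y \<longleftrightarrow> (x, y) \<in> E)}"

definition stationary_distribution ::
  "'a set \<Rightarrow> ('a \<Rightarrow> 'a \<Rightarrow> real) \<Rightarrow> ('a \<Rightarrow> real) \<Rightarrow> bool" where
  "stationary_distribution X P \<pi> \<longleftrightarrow>
     (\<forall>x\<in>X. 0 \<le> \<pi> x) \<and> (\<Sum>x\<in>X. \<pi> x) = 1 \<and>
     (\<forall>y\<in>X. (\<Sum>x\<in>X. \<pi> x * P x y) = \<pi> y)"

text \<open>
  For the kernels considered here the stationary distribution is unique on \<open>X\<close> and positive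
  (\<open>stationary_distribution_unique\<close>, \<open>stationary_distribution_pos\<close> below), so the existential
  quantifier refers to the stationary distribution of \<open>P\<close>.
\<close>

definition reversible :: "'a set \<Rightarrow> ('a \<Rightarrow> 'a \<Rightarrow> real) \<Rightarrow> bool" where
  "reversible X P \<longleftrightarrow>
     (\<exists>\<pi>. stationary_distribution X P \<pi> \<and> (\<forall>x\<in>X. \<forall>y\<in>X. \<pi> x * P x y = \<pi> y * P y x))"

definition independent_mod_trivial ::
  "('a \<times> 'a) set \<Rightarrow> ('d::finite \<Rightarrow> 'a \<Rightarrow> 'a \<Rightarrow> real) \<Rightarrow> bool" where
  "independent_mod_trivial E g \<longleftrightarrow>
     (\<forall>(a :: 'd \<Rightarrow> real) (f :: 'a \<Rightarrow> real) (c :: real).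
        (\<forall>(x, y)\<in>E. (\<Sum>i\<in>UNIV. a i * g i x y) = f y - f x + c) \<longrightarrow> (\<forall>i. a i = 0))"

text \<open>
  The number \<open>d\<close> of generators is \<open>CARD('d)\<close>.  The family \<open>{P\<^sub>\<theta> : \<theta> \<in> \<Theta>}\<close> is given by its
  parametrization \<open>P\<close>, whose values outside \<open>\<Theta>\<close> are irrelevant.
\<close>

definition e_family ::
  "'a set \<Rightarrow> ('a \<times> 'a) set \<Rightarrow> ('a \<Rightarrow> 'a \<Rightarrow> real) \<Rightarrow> ('d::finite \<Rightarrow> 'a \<Rightarrow> 'a \<Rightarrow> real) \<Rightarrow>
   (real ^ 'd) set \<Rightarrow> (real ^ 'd \<Rightarrow> 'a \<Rightarrow> 'a \<Rightarrow> real) \<Rightarrow> bool" where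
  "e_family X E K g \<Theta> P \<longleftrightarrow>
     connected \<Theta> \<and> (\<exists>r>0. ball 0 r \<subseteq> \<Theta>) \<and>
     independent_mod_trivial E g \<and>
     P ` \<Theta> \<subseteq> transition_kernels X E \<and>
     (\<exists>(R :: real ^ 'd \<Rightarrow> 'a \<Rightarrow> real) (\<psi> :: real ^ 'd \<Rightarrow> real).
        \<forall>\<theta>\<in>\<Theta>. \<forall>x\<in>X. \<forall>y\<in>X.
          ((x, y) \<in> E \<longrightarrow>
             ln (P \<theta> x y) = K x y + (\<Sum>i\<in>UNIV. \<theta> $ i * g i x y) + R \<theta> y - R \<theta> x - \<psi> \<theta>) \<and>
          ((x, y) \<notin> E \<longrightarrow> P \<theta> x y = 0))"

text \<open>Only meaningful for \<open>E = E\<inverse>\<close>: otherwise \<open>h\<close> is also evaluated at reversed edges outside \<open>E\<close>.\<close>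

definition log_reversible :: "('a \<times> 'a) set \<Rightarrow> ('a \<Rightarrow> 'a \<Rightarrow> real) \<Rightarrow> bool" where
  "log_reversible E h \<longleftrightarrow>
     (\<forall>(n :: nat) (x :: nat \<Rightarrow> 'a).
        1 \<le> n \<and> (\<forall>t\<in>{1..n}. (x t, x (t + 1)) \<in> E) \<and> x (n + 1) = x 1 \<longrightarrow>
        (\<Sum>t=1..n. h (x t) (x (t + 1))) = (\<Sum>t=1..n. h (x (t + 1)) (x t)))"

lemma invariant_pos:
  assumes X: "finite X" "strongly_connected_on X E" and P: "P \<in> transition_kernels X E"
    and nonneg: "\<And>x. x \<in> X \<Longrightarrow> 0 \<le> v x"
    and inv: "\<And>y. y \<in> X \<Longrightarrow> (\<Sum>x\<in>X. v x * P x y) = v y"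
    and x: "x \<in> X" "0 < v x" and y: "y \<in> X"
  shows "0 < v y"
proof -
  have "(x, y) \<in> E\<^sup>*" using X x y by (auto simp: strongly_connected_on_def)
  then show ?thesis
  proof induction
    case base
    then show ?case using x by simp
  next
    case (step u w)
    have uw: "u \<in> X" "w \<in> X" using step X by (auto simp: strongly_connected_on_def)
    have "0 < v u * P u w" using P step uw by (auto simp: transition_kernels_def)
    also have "\<dots> \<le> (\<Sum>z\<in>X. v z * P z w)"
      using X uw P nonneg
      by (intro member_le_sum)
         (auto simp: transition_kernels_def row_stochastic_def)
    finally show ?case using inv uw by simp
  qed
qed

lemma stationary_distribution_pos:
  assumes "finite X" "strongly_connected_on X E" "P \<in> transition_kernels X E"
    and st: "stationary_distribution X P \<pi>" and y: "y \<in> X"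
  shows "0 < \<pi> y"
proof -
  have "(\<Sum>x\<in>X. \<pi> x) \<noteq> 0" using st by (simp add: stationary_distribution_def)
  then obtain x where "x \<in> X" "\<pi> x \<noteq> 0" by (meson sum.neutral)
  moreover from this have "0 < \<pi> x" using st by (force simp: stationary_distribution_def)
  ultimately show ?thesis
    using invariant_pos[OF assms(1-3), of \<pi> x y] st y
    by (auto simp: stationary_distribution_def)
qed

lemma stationary_distribution_unique:
  assumes X: "finite X" "strongly_connected_on X E" "P \<in> transition_kernels X E"
    and p: "stationary_distribution X P p" and q: "stationary_distribution X P q"
    and x: "x \<in> X"
  shows "p x = q x"
proof -
  define c where "c = Min ((\<lambda>z. q z / p z) ` X)"
  define v where "v = (\<lambda>z. q z - c * p z)"
  have ppos: "\<And>z. z \<in> X \<Longrightarrow> 0 < p z" using stationary_distribution_pos[OF X p] .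
  have "c \<in> (\<lambda>z. q z / p z) ` X" unfolding c_def using X x by (intro Min_in) auto
  then obtain y where y: "y \<in> X" "c = q y / p y" by auto
  have vy: "v y = 0" using y ppos[of y] by (simp add: v_def)
  have nonneg: "0 \<le> v z" if "z \<in> X" for z
  proof -
    have "c \<le> q z / p z" unfolding c_def using X that by (intro Min_le) auto
    then show ?thesis using ppos[OF that] by (simp add: v_def field_simps)
  qed
  have inv: "(\<Sum>u\<in>X. v u * P u w) = v w" if "w \<in> X" for w
  proof -
    have "(\<Sum>u\<in>X. v u * P u w) = (\<Sum>u\<in>X. q u * P u w) - c * (\<Sum>u\<in>X. p u * P u w)"
      by (simp add: v_def algebra_simps sum_subtractf sum_distrib_left)
    then show ?thesis using p q that by (simp add: stationary_distribution_def v_def)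
  qed
  have zero: "v z = 0" if "z \<in> X" for z
    using invariant_pos[OF X nonneg inv that _ y(1)] vy nonneg[OF that] by fastforce
  have "(\<Sum>z\<in>X. q z) = (\<Sum>z\<in>X. c * p z)"
    using zero by (intro sum.cong) (auto simp: v_def)
  then have "c = 1" using p q by (simp add: stationary_distribution_def flip: sum_distrib_left)
  then show ?thesis using zero[OF x] by (simp add: v_def)
qed

end

theory Submission
  imports Defs
begin

text \<open>
  On a strongly connected graph, \<open>h\<close> is log-reversible iff its antisymmetrization
  \<open>h x y - h y x\<close> is a potential difference \<open>f y - f x\<close>.  Applied to \<open>ln P\<close> this is Kolmogorov's
  criterion: \<open>exp f\<close> normalizes to a distribution in detailed balance with \<open>P\<close>, and conversely
  \<open>f = ln \<pi>\<close>.  Log-reversible functions form a linear space that contains every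
  \<open>f y - f x + c\<close>, so all \<open>P\<^sub>\<theta>\<close> are reversible iff \<open>K + \<Sum>\<^sub>i \<theta>\<^sup>i g\<^sub>i\<close> is log-reversible for all \<open>\<theta>\<close>;
  taking \<open>\<theta> = 0\<close> and small multiples of the unit vectors isolates \<open>K\<close> and each \<open>g\<^sub>i\<close>.
\<close>

text \<open>A relation rather than a function, since different walks between the same endpoints may
  have different sums. Walks grow at their far end, so inductions run parallel to those on
  \<open>E\<^sup>*\<close>.\<close>

inductive walk_sum :: "('a \<times> 'a) set \<Rightarrow> ('a \<Rightarrow> 'a \<Rightarrow> real) \<Rightarrow> 'a \<Rightarrow> 'a \<Rightarrow> real \<Rightarrow> bool"
  for E d where
  refl: "walk_sum E d x x 0"
| step: "walk_sum E d x y s \<Longrightarrow> (y, z) \<in> E \<Longrightarrow> walk_sum E d x z (s + d y z)"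

lemma walk_sum_trans:
  assumes "walk_sum E d y z t" "walk_sum E d x y s"
  shows "walk_sum E d x z (s + t)"
  using assms
proof induction
  case (step y z t w)
  then show ?case using walk_sum.step[of E d x z "s + t" w] by (simp add: add.assoc)
qed simp

lemma rtrancl_imp_walk_sum:
  assumes "(x, y) \<in> E\<^sup>*"
  shows "\<exists>s. walk_sum E d x y s"
  using assms by induction (blast intro: walk_sum.intros)+

lemma walk_sum_imp_path:
  assumes "walk_sum E d x y s"
  shows "\<exists>(n::nat) p. p 1 = x \<and> p (n + 1) = y \<and> (\<forall>t\<in>{1..n}. (p t, p (t + 1)) \<in> E) \<and>
           s = (\<Sum>t=1..n. d (p t) (p (t + 1)))"
  using assms
proof induction
  case (refl x)
  show ?case by (intro exI[of _ 0] exI[of _ "\<lambda>_. x"]) simp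
next
  case (step x y s z)
  then obtain n :: nat and p where p: "p 1 = x" "p (n + 1) = y"
    "\<forall>t\<in>{1..n}. (p t, p (t + 1)) \<in> E" "s = (\<Sum>t=1..n. d (p t) (p (t + 1)))" by blast
  \<comment> \<open>A walk of \<open>n\<close> edges occupies the positions 1 to
    \<open>n + 1\<close>, so the new endpoint goes to \<open>n + 2\<close> and the earlier terms of
    the sum do not change.\<close>
  define q where "q = p(Suc (Suc n) := z)"
  have "(\<Sum>t=1..n. d (q t) (q (t + 1))) = s"
    unfolding p(4) by (intro sum.cong) (auto simp: q_def)
  then show ?case using p step.hyps
    by (intro exI[of _ "Suc n"] exI[of _ q]) (auto simp: q_def le_Suc_eq)
qed

text \<open>Along a closed walk the antisymmetrization sums to the difference of the two sides in
  \<open>log_reversible_def\<close>. The empty walk is treated apart because that definition asks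
  for \<open>1 \<le> n\<close>.\<close>

lemma log_reversible_closed_walk_sum:
  assumes "log_reversible E h" "walk_sum E (\<lambda>x y. h x y - h y x) x x s"
  shows "s = 0"
proof -
  obtain n :: nat and p where p: "p 1 = x" "p (n + 1) = x"
    "\<forall>t\<in>{1..n}. (p t, p (t + 1)) \<in> E"
    "s = (\<Sum>t=1..n. h (p t) (p (t + 1)) - h (p (t + 1)) (p t))"
    using walk_sum_imp_path[OF assms(2)] by blast
  show ?thesis
  proof (cases "n = 0")
    case False
    with p have "1 \<le> n \<and> (\<forall>t\<in>{1..n}. (p t, p (t + 1)) \<in> E) \<and> p (n + 1) = p 1" by simp
    with assms(1) show ?thesis unfolding log_reversible_def p(4) sum_subtractf by simp
  qed (use p in simp)
qed

lemma sum_closed_path_diff: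
  fixes f :: "'a \<Rightarrow> real" and x :: "nat \<Rightarrow> 'a"
  assumes "x (n + 1) = x 1"
  shows "(\<Sum>t=1..n. f (x (t + 1)) - f (x t)) = 0"
  using sum_Suc_diff[of 1 n "\<lambda>t. f (x t)"] assms by simp

lemma log_reversible_iff_potential:
  assumes "strongly_connected_on X E"
  shows "log_reversible E h \<longleftrightarrow> (\<exists>f. \<forall>(x, y)\<in>E. h x y - h y x = f y - f x)"
proof
  assume lr: "log_reversible E h"
  let ?d = "\<lambda>x y. h x y - h y x"
  have EX: "E \<subseteq> X \<times> X" and conn: "\<And>x y. x \<in> X \<Longrightarrow> y \<in> X \<Longrightarrow> (x, y) \<in> E\<^sup>*"
    using assms by (auto simp: strongly_connected_on_def)
  show "\<exists>f. \<forall>(x, y)\<in>E. ?d x y = f y - f x"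
  proof (cases "X = {}")
    case False
    then obtain u where u: "u \<in> X" by blast
    \<comment> \<open>The potential is minus the sum along a return walk to \<open>u\<close>, so no walk has to be reversed.\<close>
    obtain r where r: "\<And>y. y \<in> X \<Longrightarrow> walk_sum E ?d y u (r y)"
      using rtrancl_imp_walk_sum[OF conn[OF _ u], of _ ?d] by metis
    \<comment> \<open>Any walk from \<open>u\<close> to \<open>y\<close>, followed by the chosen
      return walk, is closed. Hence all walks from \<open>u\<close> to \<open>y\<close> have the
      same sum.\<close>
    have out: "s = - r y" if "walk_sum E ?d u y s" "y \<in> X" for y s
      using log_reversible_closed_walk_sum[OF lr walk_sum_trans[OF r[OF that(2)] that(1)]] by simp
    have "?d y z = - r z - (- r y)" if yz: "(y, z) \<in> E" for y z
    proof -
      have yzX: "y \<in> X" "z \<in> X" using yz EX by auto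
      obtain s where s: "walk_sum E ?d u y s"
        using rtrancl_imp_walk_sum[OF conn[OF u yzX(1)]] by blast
      \<comment> \<open>Compare a walk from \<open>u\<close> to \<open>y\<close> with its extension
        by the edge to \<open>z\<close>.\<close>
      show ?thesis using out[OF s yzX(1)] out[OF walk_sum.step[OF s yz] yzX(2)] by simp
    qed
    then show ?thesis by (intro exI[of _ "\<lambda>y. - r y"]) blast
  qed (use EX in auto)
next
  assume "\<exists>f. \<forall>(x, y)\<in>E. h x y - h y x = f y - f x"
  then obtain f where f: "\<And>x y. (x, y) \<in> E \<Longrightarrow> h x y - h y x = f y - f x" by blast
  show "log_reversible E h"
    unfolding log_reversible_def
  proof (intro allI impI, elim conjE)
    fix n :: nat and x :: "nat \<Rightarrow> 'a"
    assume e: "\<forall>t\<in>{1..n}. (x t, x (t + 1)) \<in> E" and c: "x (n + 1) = x 1"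
    have "(\<Sum>t=1..n. h (x t) (x (t + 1)) - h (x (t + 1)) (x t)) =
        (\<Sum>t=1..n. f (x (t + 1)) - f (x t))"
      using e f by (intro sum.cong) auto
    then show "(\<Sum>t=1..n. h (x t) (x (t + 1))) = (\<Sum>t=1..n. h (x (t + 1)) (x t))"
      using sum_closed_path_diff[of x n f] c by (simp add: sum_subtractf)
  qed
qed

text \<open>Log-reversibility also evaluates functions at reversed edges; symmetry of
  \<open>E\<close> carries the agreement on edges over to them.\<close>

lemma log_reversible_cong:
  assumes "\<And>x y. (x, y) \<in> E \<Longrightarrow> h x y = k x y" "E = E\<inverse>" "log_reversible E h"
  shows "log_reversible E k"
proof -
  have "k y x = h y x" if "(x, y) \<in> E" for x y
    using that assms(1,2) by (metis converse_iff)
  then show ?thesis using assms(1,3) by (simp add: log_reversible_def)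
qed

lemma log_reversible_add:
  assumes "log_reversible E h" "log_reversible E k"
  shows "log_reversible E (\<lambda>x y. h x y + k x y)"
  using assms by (simp add: log_reversible_def sum.distrib)

lemma log_reversible_cmult:
  assumes "log_reversible E h"
  shows "log_reversible E (\<lambda>x y. c * h x y)"
  using assms by (simp add: log_reversible_def flip: sum_distrib_left)

lemma log_reversible_sum:
  fixes E :: "('a \<times> 'a) set"
  assumes "\<And>i. i \<in> I \<Longrightarrow> log_reversible E (h i)"
  shows "log_reversible E (\<lambda>x y. \<Sum>i\<in>I. h i x y)"
  unfolding log_reversible_def
proof (intro allI impI)
  fix n :: nat and x :: "nat \<Rightarrow> 'a"
  assume A: "1 \<le> n \<and> (\<forall>t\<in>{1..n}. (x t, x (t + 1)) \<in> E) \<and> x (n + 1) = x 1"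
  have "(\<Sum>i\<in>I. \<Sum>t=1..n. h i (x t) (x (t + 1))) = (\<Sum>i\<in>I. \<Sum>t=1..n. h i (x (t + 1)) (x t))"
    using assms[unfolded log_reversible_def, rule_format, OF _ A] by (rule sum.cong[OF HOL.refl])
  then show "(\<Sum>t=1..n. \<Sum>i\<in>I. h i (x t) (x (t + 1))) = (\<Sum>t=1..n. \<Sum>i\<in>I. h i (x (t + 1)) (x t))"
    by (subst (1 2) sum.swap)
qed

text \<open>Potential differences telescope to zero around a closed path, and \<open>c\<close> is
  counted once per edge in either direction.\<close>

lemma log_reversible_coboundary:
  fixes E :: "('a \<times> 'a) set"
  shows "log_reversible E (\<lambda>x y. f y - f x + c)"
  unfolding log_reversible_def
proof (intro allI impI)
  fix n :: nat and x :: "nat \<Rightarrow> 'a"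
  assume "1 \<le> n \<and> (\<forall>t\<in>{1..n}. (x t, x (t + 1)) \<in> E) \<and> x (n + 1) = x 1"
  then show "(\<Sum>t=1..n. f (x (t + 1)) - f (x t) + c) = (\<Sum>t=1..n. f (x t) - f (x (t + 1)) + c)"
    using sum_closed_path_diff[of x n f] by (simp add: sum.distrib sum_subtractf)
qed

lemma reversible_iff_log_reversible:
  assumes X: "finite X" "X \<noteq> {}" "strongly_connected_on X E" and P: "P \<in> transition_kernels X E"
  shows "reversible X P \<longleftrightarrow> E = E\<inverse> \<and> log_reversible E (\<lambda>x y. ln (P x y))"
proof -
  have EX: "\<And>x y. (x, y) \<in> E \<Longrightarrow> x \<in> X \<and> y \<in> X"
    using X by (auto simp: strongly_connected_on_def)
  have pos: "\<And>x y. x \<in> X \<Longrightarrow> y \<in> X \<Longrightarrow> 0 < P x y \<longleftrightarrow> (x, y) \<in> E"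
    and nonneg: "\<And>x y. x \<in> X \<Longrightarrow> y \<in> X \<Longrightarrow> 0 \<le> P x y"
    and row: "\<And>x. x \<in> X \<Longrightarrow> (\<Sum>y\<in>X. P x y) = 1"
    using P by (auto simp: transition_kernels_def row_stochastic_def)
  show ?thesis
    unfolding log_reversible_iff_potential[OF X(3)]
  proof (intro iffI; (elim conjE exE)?)
    assume "reversible X P"
    then obtain \<pi> where st: "stationary_distribution X P \<pi>"
      and db: "\<And>x y. x \<in> X \<Longrightarrow> y \<in> X \<Longrightarrow> \<pi> x * P x y = \<pi> y * P y x"
      by (auto simp: reversible_def)
    have \<pi>: "\<And>x. x \<in> X \<Longrightarrow> 0 < \<pi> x"
      using stationary_distribution_pos[OF X(1,3) P st] .
    \<comment> \<open>Since \<pi> is positive, both sides of detailed balance are positive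
      together.\<close>
    have sym: "(y, x) \<in> E" if "(x, y) \<in> E" for x y
    proof -
      have "0 < \<pi> x * P x y" using pos[of x y] \<pi>[of x] EX[OF that] that by simp
      then have "0 < \<pi> y * P y x" using db[of x y] EX[OF that] by simp
      then show ?thesis using pos[of y x] \<pi>[of y] EX[OF that] by (simp add: zero_less_mult_iff)
    qed
    have "ln (P x y) - ln (P y x) = ln (\<pi> y) - ln (\<pi> x)" if "(x, y) \<in> E" for x y
    proof -
      have "ln (\<pi> x * P x y) = ln (\<pi> y * P y x)" using db EX[OF that] by simp
      then show ?thesis
        using \<pi>[of x] \<pi>[of y] pos[of x y] pos[of y x] EX[OF that] that sym[OF that]
        by (simp add: ln_mult)
    qed
    then have "\<forall>(x, y)\<in>E. ln (P x y) - ln (P y x) = ln (\<pi> y) - ln (\<pi> x)" by blast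
    then show "E = E\<inverse> \<and> (\<exists>f. \<forall>(x, y)\<in>E. ln (P x y) - ln (P y x) = f y - f x)"
      using sym by (intro conjI exI[of _ "\<lambda>x. ln (\<pi> x)"]) auto
  next
    fix f assume sym: "E = E\<inverse>" and f: "\<forall>(x, y)\<in>E. ln (P x y) - ln (P y x) = f y - f x"
    define Z where "Z = (\<Sum>x\<in>X. exp (f x))"
    define \<pi> where "\<pi> x = exp (f x) / Z" for x
    have Z: "0 < Z" unfolding Z_def using X by (intro sum_pos) auto
    \<comment> \<open>On edges, exponentiating the potential equation gives detailed balance. Off
      the edges, where \<open>f\<close> says nothing, symmetry of \<open>E\<close> makes both sides
      vanish.\<close>
    have db: "\<pi> x * P x y = \<pi> y * P y x" if "x \<in> X" "y \<in> X" for x y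
    proof (cases "(x, y) \<in> E")
      case True
      have yx: "(y, x) \<in> E" using True sym by (metis converse_iff)
      have "f x + ln (P x y) = f y + ln (P y x)" using f True by force
      then have "exp (f x) * exp (ln (P x y)) = exp (f y) * exp (ln (P y x))"
        by (simp flip: exp_add)
      then show ?thesis using pos[OF that] pos[OF that(2,1)] True yx by (simp add: \<pi>_def)
    next
      case False
      have yx: "(y, x) \<notin> E" using False sym by (metis converse_iff)
      have "P x y = 0" "P y x = 0"
        using pos[OF that] pos[OF that(2,1)] nonneg[OF that] nonneg[OF that(2,1)] False yx by auto
      then show ?thesis by simp
    qed
    \<comment> \<open>Detailed balance turns the column sum into a row sum, which is 1.\<close>
    have "(\<Sum>x\<in>X. \<pi> x * P x y) = \<pi> y" if "y \<in> X" for y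
    proof -
      have "(\<Sum>x\<in>X. \<pi> x * P x y) = (\<Sum>x\<in>X. \<pi> y * P y x)"
        using db that by (intro sum.cong) auto
      then show ?thesis using row[OF that] by (simp flip: sum_distrib_left)
    qed
    moreover have "(\<Sum>x\<in>X. \<pi> x) = 1"
      using Z by (simp add: \<pi>_def Z_def flip: sum_divide_distrib)
    ultimately have "stationary_distribution X P \<pi>"
      using Z by (simp add: stationary_distribution_def \<pi>_def)
    then show "reversible X P" using db by (auto simp: reversible_def)
  qed
qed

theorem theorem4p2:
  fixes X :: "'a set"
    and E :: "('a \<times> 'a) set"
    and K :: "'a \<Rightarrow> 'a \<Rightarrow> real"
    and g :: "'d::finite \<Rightarrow> 'a \<Rightarrow> 'a \<Rightarrow> real"
    and \<Theta> :: "(real ^ 'd) set"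
    and P :: "real ^ 'd \<Rightarrow> 'a \<Rightarrow> 'a \<Rightarrow> real"
  assumes "finite X" and "card X \<ge> 2"
    and "strongly_connected_on X E"
    and "e_family X E K g \<Theta> P"
  shows "(\<forall>Q \<in> P ` \<Theta>. reversible X Q) \<longleftrightarrow>
         (E = E\<inverse> \<and> log_reversible E K \<and> (\<forall>i. log_reversible E (g i)))"
proof -
  have X: "finite X" "X \<noteq> {}" "strongly_connected_on X E" using assms by auto
  have EX: "\<And>x y. (x, y) \<in> E \<Longrightarrow> x \<in> X \<and> y \<in> X"
    using X by (auto simp: strongly_connected_on_def)
  obtain r where r: "r > 0" "ball 0 r \<subseteq> \<Theta>"
    and ker: "\<And>\<theta>. \<theta> \<in> \<Theta> \<Longrightarrow> P \<theta> \<in> transition_kernels X E"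
    using assms(4) by (auto simp: e_family_def)
  obtain R \<psi> where "\<forall>\<theta>\<in>\<Theta>. \<forall>x\<in>X. \<forall>y\<in>X. (x, y) \<in> E \<longrightarrow>
      ln (P \<theta> x y) = K x y + (\<Sum>i\<in>UNIV. \<theta> $ i * g i x y) + R \<theta> y - R \<theta> x - \<psi> \<theta>"
    using assms(4) unfolding e_family_def by blast
  then have lnP: "ln (P \<theta> x y) = K x y + (\<Sum>i\<in>UNIV. \<theta> $ i * g i x y) + R \<theta> y - R \<theta> x - \<psi> \<theta>"
    if "\<theta> \<in> \<Theta>" "(x, y) \<in> E" for \<theta> x y using that EX by blast
  let ?h = "\<lambda>\<theta> x y. K x y + (\<Sum>i\<in>UNIV. \<theta> $ i * g i x y)"
  have rev_iff: "reversible X (P \<theta>) \<longleftrightarrow> E = E\<inverse> \<and> log_reversible E (?h \<theta>)" if \<theta>: "\<theta> \<in> \<Theta>" for \<theta>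
  proof -
    \<comment> \<open>The formula for \<open>ln (P \<theta> x y)\<close> is known on edges only, so
      symmetry is required to use it at reversed edges. The coboundaries added below cancel the
      terms in \<open>R\<close> and \<psi>.\<close>
    have "log_reversible E (\<lambda>x y. ln (P \<theta> x y)) \<longleftrightarrow> log_reversible E (?h \<theta>)" if sym: "E = E\<inverse>"
    proof
      assume "log_reversible E (\<lambda>x y. ln (P \<theta> x y))"
      from log_reversible_add[OF this log_reversible_coboundary[of E "\<lambda>x. - R \<theta> x" "\<psi> \<theta>"]]
      show "log_reversible E (?h \<theta>)"
        by (rule log_reversible_cong[OF _ sym, rotated]) (simp add: lnP[OF \<theta>])
    next
      assume "log_reversible E (?h \<theta>)"
      from log_reversible_add[OF this log_reversible_coboundary[of E "R \<theta>" "- \<psi> \<theta>"]]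
      show "log_reversible E (\<lambda>x y. ln (P \<theta> x y))"
        by (rule log_reversible_cong[OF _ sym, rotated]) (simp add: lnP[OF \<theta>])
    qed
    then show ?thesis using reversible_iff_log_reversible[OF X ker[OF \<theta>]] by blast
  qed
  show ?thesis
  proof (intro iffI conjI allI)
    assume "\<forall>Q \<in> P ` \<Theta>. reversible X Q"
    then have h: "\<And>\<theta>. \<theta> \<in> \<Theta> \<Longrightarrow> E = E\<inverse> \<and> log_reversible E (?h \<theta>)" using rev_iff by blast
    have zero: "0 \<in> \<Theta>" using r by auto
    show sym: "E = E\<inverse>" using h[OF zero] by blast
    show K: "log_reversible E K" using h[OF zero] by simp
    fix j
    \<comment> \<open>A unit vector scaled by \<open>r / 2\<close> lies inside the ball of radius
      \<open>r\<close>, hence in \<Theta>.\<close>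
    define \<theta> :: "real ^ 'd" where "\<theta> = (r / 2) *\<^sub>R axis j 1"
    have "\<theta> \<in> \<Theta>" using r by (auto simp: \<theta>_def norm_axis_1 intro!: subsetD[OF r(2)])
    then have "log_reversible E (?h \<theta>)" using h by blast
    moreover have "(\<Sum>i\<in>UNIV. \<theta> $ i * g i x y) = r / 2 * g j x y" for x y
    proof -
      have "(\<Sum>i\<in>UNIV. \<theta> $ i * g i x y) = (\<Sum>i\<in>UNIV. if i = j then r / 2 * g j x y else 0)"
        by (intro sum.cong) (auto simp: \<theta>_def axis_def)
      then show ?thesis by simp
    qed
    ultimately have "log_reversible E (\<lambda>x y. K x y + r / 2 * g j x y)" by simp
    \<comment> \<open>Subtract \<open>K\<close>, already known to be log-reversible, and undo the
      scaling.\<close>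
    from log_reversible_cmult[OF log_reversible_add[OF this log_reversible_cmult[OF K, of "-1"]],
        of "2 / r"]
    show "log_reversible E (g j)" using r(1) by simp
  next
    assume "E = E\<inverse> \<and> log_reversible E K \<and> (\<forall>i. log_reversible E (g i))"
    then have "E = E\<inverse> \<and> log_reversible E (?h \<theta>)" for \<theta>
      by (auto intro!: log_reversible_add log_reversible_sum log_reversible_cmult)
    then show "\<forall>Q \<in> P ` \<Theta>. reversible X Q" using rev_iff by blast
  qed
qed

end
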